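(* There is no algorithm in the read/write streams model that uses only one stream, $\log^{O(1)} n$ bits of internal memory and $\log^{O(1)} n$ passes and that, on every input string $s$ of length $n$, outputs a context-free grammar $\mathsf{APPROX}$ generating $s$ and only $s$ with $|\mathsf{APPROX}|\le|\mathsf{OPT}|^{O(1)}$, where $\mathsf{OPT}$ is a smallest grammar generating $s$ and only $s$.
   Context: Read/write streams model: an algorithm has an internal memory of $m$ bits and access to a fixed number of streams (tapes); each stream is a sequence of cells accessed sequentially by a read/write head; a pass is one sequential sweep over a stream. The input string $s$ of length $n$ is initially on the first stream. Grammar sizes are measured in bits. *)

theory Defs
  imports Complex_Main
begin

section \<open>Context-free grammars and their size in bits\<close>

text \<open>Letters and nonterminals are natural numbers; a string over an alphabet with \<open>\<sigma>\<close> letters is a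
  list over \<open>{..<\<sigma>}\<close>.  A nonterminal may have any number of productions, so these are arbitrary
  context-free grammars, not only straight-line ones.\<close>

datatype sym = T nat | N nat

datatype cfg = CFG (start: nat) (prods: "(nat \<times> sym list) list")

definition derives1 :: "cfg \<Rightarrow> sym list \<Rightarrow> sym list \<Rightarrow> bool" where
  "derives1 G x y \<longleftrightarrow>
     (\<exists>u A \<alpha> v. (A, \<alpha>) \<in> set (prods G) \<and> x = u @ [N A] @ v \<and> y = u @ \<alpha> @ v)"

definition language :: "cfg \<Rightarrow> nat list set" where
  "language G = {w. (derives1 G)\<^sup>*\<^sup>* [N (start G)] (map T w)}"

definition generates_only :: "cfg \<Rightarrow> nat list \<Rightarrow> bool" where
  "generates_only G s \<longleftrightarrow> language G = {s}"

text \<open>A concrete self-delimiting binary encoding.  A number is written as its binary digits, least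
  significant first, each preceded by a continuation flag, so it takes \<open>O(log n)\<close> bits; lists use
  the same flags.  A grammar with \<open>g\<close> symbol occurrences, named by numbers polynomial in \<open>g\<close>,
  therefore takes \<open>O(g log g)\<close> bits.\<close>

fun nat_code :: "nat \<Rightarrow> bool list" where
  "nat_code 0 = [False]"
| "nat_code (Suc n) = True # odd (Suc n) # nat_code (Suc n div 2)"

fun sym_code :: "sym \<Rightarrow> bool list" where
  "sym_code (T a) = False # nat_code a"
| "sym_code (N A) = True # nat_code A"

fun list_code :: "('b \<Rightarrow> bool list) \<Rightarrow> 'b list \<Rightarrow> bool list" where
  "list_code f [] = [False]"
| "list_code f (x # xs) = True # f x @ list_code f xs"

fun prod_code :: "nat \<times> sym list \<Rightarrow> bool list" where
  "prod_code (A, \<alpha>) = nat_code A @ list_code sym_code \<alpha>"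

definition cfg_code :: "cfg \<Rightarrow> bool list" where
  "cfg_code G = nat_code (start G) @ list_code prod_code (prods G)"

definition cfg_size :: "cfg \<Rightarrow> nat" where
  "cfg_size G = length (cfg_code G)"

definition smallest_grammar :: "cfg \<Rightarrow> nat list \<Rightarrow> bool" where
  "smallest_grammar G s \<longleftrightarrow>
     generates_only G s \<and> (\<forall>H. generates_only H s \<longrightarrow> cfg_size G \<le> cfg_size H)"

text \<open>The encoding determines the grammar.\<close>

lemma nat_code_append_inject:
  "nat_code x @ u = nat_code y @ v \<longleftrightarrow> x = y \<and> u = v"
proof (induction x arbitrary: y rule: less_induct)
  case (less x)
  show ?case
  proof (cases x)
    case 0
    then show ?thesis by (cases y) auto
  next
    case (Suc k)
    show ?thesis
    proof (cases y)
      case 0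
      with Suc show ?thesis by auto
    next
      case (Suc l)
      have "x div 2 < x" using \<open>x = Suc k\<close> by simp
      from less.IH[OF this, of "y div 2"]
      have "nat_code x @ u = nat_code y @ v \<longleftrightarrow>
              odd x = odd y \<and> x div 2 = y div 2 \<and> u = v"
        using \<open>x = Suc k\<close> \<open>y = Suc l\<close> by simp
      moreover have "odd x = odd y \<and> x div 2 = y div 2 \<longleftrightarrow> x = y"
        by presburger
      ultimately show ?thesis by blast
    qed
  qed
qed

lemma sym_code_append_inject:
  "sym_code x @ u = sym_code y @ v \<longleftrightarrow> x = y \<and> u = v"
  by (cases x; cases y) (auto simp: nat_code_append_inject)

lemma list_code_append_inject:
  assumes "\<And>x y u v. f x @ u = f y @ v \<longleftrightarrow> x = y \<and> u = v"
  shows "list_code f xs @ u = list_code f ys @ v \<longleftrightarrow> xs = ys \<and> u = v"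
proof (induction xs arbitrary: ys)
  case Nil
  then show ?case by (cases ys) auto
next
  case (Cons x xs)
  then show ?case by (cases ys) (auto simp: assms)
qed

lemma prod_code_append_inject:
  "prod_code x @ u = prod_code y @ v \<longleftrightarrow> x = y \<and> u = v"
  by (cases x; cases y)
     (auto simp: nat_code_append_inject list_code_append_inject[OF sym_code_append_inject])

lemma inj_cfg_code: "inj cfg_code"
proof (rule injI)
  fix G H assume "cfg_code G = cfg_code H"
  then show "G = H"
    using list_code_append_inject[OF prod_code_append_inject, of "prods G" "[]" "prods H" "[]"]
    by (cases G; cases H) (auto simp: cfg_code_def nat_code_append_inject)
qed

lemma generates_only_trivial: "generates_only (CFG 0 [(0, map T s)]) s"
proof -
  let ?G = "CFG 0 [(0, map T s)]"
  have step: "derives1 ?G [N 0] y \<longleftrightarrow> y = map T s" for y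
    by (auto simp: derives1_def Cons_eq_append_conv)
  have stuck: "\<not> derives1 ?G (map T w) y" for w y
    by (auto simp: derives1_def map_eq_append_conv)
  have "w = s" if "(derives1 ?G)\<^sup>*\<^sup>* [N 0] (map T w)" for w
    using that
  proof (cases rule: converse_rtranclpE)
    case base
    then show ?thesis by (cases w) auto
  next
    case (step y)
    then have "(derives1 ?G)\<^sup>*\<^sup>* (map T s) (map T w)"
      using \<open>\<And>y. derives1 ?G [N 0] y \<longleftrightarrow> y = map T s\<close> by simp
    then have "map T s = map T w"
      by (cases rule: converse_rtranclpE) (auto simp: stuck)
    then show ?thesis
      by (auto dest!: map_injective simp: inj_def)
  qed
  moreover have "(derives1 ?G)\<^sup>*\<^sup>* [N 0] (map T s)"
    using step by blast
  ultimately show ?thesis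
    by (auto simp: generates_only_def language_def)
qed

lemma ex_smallest_grammar: "\<exists>G. smallest_grammar G s"
  using ex_has_least_nat[of "\<lambda>G. generates_only G s" _ cfg_size] generates_only_trivial[of s]
  unfolding smallest_grammar_def by blast

section \<open>Read/write streams with a single stream\<close>

text \<open>The stream is unbounded to the right and may be overwritten and extended; \<^term>\<open>None\<close> is a
  blank cell.  Numbers that are not input letters are available as working symbols; no bound is
  put on them, so every finite stream alphabet is covered.\<close>

type_synonym cell = "nat option"

datatype dir = Leftward | Rightward

text \<open>The transition function maps the contents of the internal memory and of the scanned cell to
  the new memory contents, the symbol to write, the direction of the head movement and the bits
  appended to the output; the result \<^term>\<open>None\<close> means halting.  One transition stands for all the internal
  computation done while the head is on a cell, which like the number of bits emitted there is
  unrestricted.  The output is append-only and cannot be read back, so it provides no storage.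
  An algorithm that leaves its result on the stream is covered: it can emit it in a final sweep.\<close>

record algorithm =
  init_memory :: "bool list"
  trans :: "bool list \<Rightarrow> cell \<Rightarrow> (bool list \<times> cell \<times> dir \<times> bool list) option"

record config =
  memory :: "bool list"
  stream :: "nat \<Rightarrow> cell"
  head :: nat
  heading :: dir
  passes :: nat
  emitted :: "bool list"

definition init_config :: "algorithm \<Rightarrow> nat list \<Rightarrow> config" where
  "init_config M s =
     \<lparr>memory = init_memory M,
      stream = (\<lambda>i. if i < length s then Some (s ! i) else None),
      head = 0, heading = Rightward, passes = 1, emitted = []\<rparr>"

text \<open>A pass is a maximal sweep in one direction, so a new pass begins whenever the head reverses
  (rewinding counts as a pass).  At the left end of the stream a leftward move leaves the head in
  place.\<close>

definition next_config :: "algorithm \<Rightarrow> config \<Rightarrow> config option" where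
  "next_config M c =
     (case trans M (memory c) (stream c (head c)) of
        None \<Rightarrow> None
      | Some (q, x, d, w) \<Rightarrow> Some
          \<lparr>memory = q,
           stream = (stream c)(head c := x),
           head = (case d of Leftward \<Rightarrow> head c - 1 | Rightward \<Rightarrow> head c + 1),
           heading = d,
           passes = (if d = heading c then passes c else passes c + 1),
           emitted = emitted c @ w\<rparr>)"

definition reachable :: "algorithm \<Rightarrow> nat list \<Rightarrow> config \<Rightarrow> bool" where
  "reachable M s c \<longleftrightarrow> (\<lambda>x y. next_config M x = Some y)\<^sup>*\<^sup>* (init_config M s) c"

definition uses_memory :: "algorithm \<Rightarrow> nat list \<Rightarrow> nat \<Rightarrow> bool" where
  "uses_memory M s m \<longleftrightarrow> (\<forall>c. reachable M s c \<longrightarrow> length (memory c) \<le> m)"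

definition uses_passes :: "algorithm \<Rightarrow> nat list \<Rightarrow> nat \<Rightarrow> bool" where
  "uses_passes M s p \<longleftrightarrow> (\<forall>c. reachable M s c \<longrightarrow> passes c \<le> p)"

definition outputs :: "algorithm \<Rightarrow> nat list \<Rightarrow> bool list \<Rightarrow> bool" where
  "outputs M s w \<longleftrightarrow> (\<exists>c. reachable M s c \<and> next_config M c = None \<and> emitted c = w)"

text \<open>Bounded by a fixed power of \<open>log n\<close> for all large \<open>n\<close>; constant factors are absorbed by the exponent.\<close>

definition polylog :: "(nat \<Rightarrow> nat) \<Rightarrow> bool" where
  "polylog f \<longleftrightarrow> (\<exists>c::nat. \<forall>\<^sub>F n in sequentially. real (f n) \<le> log 2 (real n) ^ c)"

end

(* Take as input a power s of a string t of polylogarithmic length L. Repeated doubling gives s a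
   grammar of polylogarithmic size, so the output has to be shorter than the number of copies of t,
   and over some copy the machine emits nothing. The copy then influences the output only through
   its crossing sequence, which takes fewer than L bits because memory and passes are
   polylogarithmic. Hence two different periods share a silent copy and its crossing sequence.
   Splicing that copy of one input into the other does not change the output, yet a grammar
   cannot generate only s and only the spliced string. *)

theory Submission
  imports Defs "HOL-Real_Asymp.Real_Asymp"
begin

section \<open>Runs\<close>

abbreviation step :: "algorithm \<Rightarrow> config \<Rightarrow> config \<Rightarrow> bool" where
  "step M \<equiv> \<lambda>x y. next_config M x = Some y"

lemma step_cases:
  assumes "next_config M c = Some c'"
  obtains q x d w where "trans M (memory c) (stream c (head c)) = Some (q, x, d, w)"
    and "memory c' = q" and "stream c' = (stream c)(head c := x)"
    and "head c' = (case d of Leftward \<Rightarrow> head c - 1 | Rightward \<Rightarrow> head c + 1)"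
    and "heading c' = d" and "passes c' = (if d = heading c then passes c else passes c + 1)"
    and "emitted c' = emitted c @ w"
  using assms by (auto simp: next_config_def split: option.splits)

lemma next_config_eq_None_iff:
  "next_config M c = None \<longleftrightarrow> trans M (memory c) (stream c (head c)) = None"
  by (auto simp: next_config_def split: option.splits)

text \<open>A step looks only at the memory and the scanned cell, so any configuration that agrees
  there makes the same move. Heading and pass count may differ.\<close>

lemma next_config_same_view:
  assumes "next_config M c = Some c'"
    and "memory d = memory c" "head d = head c" "stream d (head c) = stream c (head c)"
  obtains x w d' where "next_config M d = Some d'" "memory d' = memory c'" "head d' = head c'"
    "stream c' = (stream c)(head c := x)" "stream d' = (stream d)(head c := x)"
    "emitted c' = emitted c @ w" "emitted d' = emitted d @ w"
proof -
  obtain q x dr w where tr: "trans M (memory c) (stream c (head c)) = Some (q, x, dr, w)"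
    using assms(1) by (rule step_cases)
  show thesis
    by (rule that[of "the (next_config M d)" x w]) (use assms tr in \<open>auto simp: next_config_def split: dir.splits\<close>)
qed

lemma step_stream_elsewhere:
  "next_config M c = Some c' \<Longrightarrow> i \<noteq> head c \<Longrightarrow> stream c' i = stream c i"
  by (erule step_cases) auto

lemma halting_config_unique:
  assumes "(step M)\<^sup>*\<^sup>* c d" "next_config M d = None"
    and "(step M)\<^sup>*\<^sup>* c d'" "next_config M d' = None"
  shows "d = d'"
  using assms(1,3)
proof (induction rule: converse_rtranclp_induct)
  case base
  then show ?case using assms(2) by (auto elim: converse_rtranclpE)
next
  case (step c e)
  from step.prems step.hyps(1) assms(4) have "(step M)\<^sup>*\<^sup>* e d'"
    by (auto elim: converse_rtranclpE)
  then show ?case by (rule step.IH)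
qed

lemma outputs_unique: "outputs M s w \<Longrightarrow> outputs M s w' \<Longrightarrow> w = w'"
  unfolding outputs_def reachable_def using halting_config_unique by blast

section \<open>Crossing sequences\<close>

text \<open>The list records memory and head position on every entry to and exit from \<open>I\<close>; headings are left
  out because they affect only the pass count.\<close>

inductive silent_run ::
    "algorithm \<Rightarrow> nat set \<Rightarrow> nat \<Rightarrow> config \<Rightarrow> (bool list \<times> nat) list \<Rightarrow> config \<Rightarrow> bool"
  for M I where
  halt: "next_config M c = None \<Longrightarrow> silent_run M I 0 c [] c"
| stay: "\<lbrakk>next_config M c = Some c'; head c \<in> I \<longleftrightarrow> head c' \<in> I;
    head c \<in> I \<Longrightarrow> emitted c' = emitted c; silent_run M I n c' cs d\<rbrakk>
    \<Longrightarrow> silent_run M I (Suc n) c cs d"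
| cross: "\<lbrakk>next_config M c = Some c'; head c \<in> I \<longleftrightarrow> head c' \<notin> I;
    head c \<in> I \<Longrightarrow> emitted c' = emitted c; silent_run M I n c' cs d\<rbrakk>
    \<Longrightarrow> silent_run M I (Suc n) c ((memory c', head c') # cs) d"

text \<open>The run of \<open>z\<close> follows that of \<open>y\<close> inside \<open>I\<close> and that of \<open>x\<close> outside; whichever of \<open>x\<close> and \<open>y\<close> is
  not being followed proceeds on its own to its next crossing.\<close>

lemma silent_run_hybrid:
  assumes "silent_run M I n x cs x'" "silent_run M I k y cs y'"
    and "head x \<in> I \<longleftrightarrow> head y \<in> I"
    and "head y \<in> I \<Longrightarrow> memory z = memory y \<and> head z = head y"
    and "head x \<notin> I \<Longrightarrow> memory z = memory x \<and> head z = head x"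
    and "\<And>i. i \<in> I \<Longrightarrow> stream z i = stream y i"
    and "\<And>i. i \<notin> I \<Longrightarrow> stream z i = stream x i"
    and "emitted z = emitted x"
  shows "\<exists>z'. (step M)\<^sup>*\<^sup>* z z' \<and> next_config M z' = None \<and> emitted z' = emitted x'"
  using assms
\<comment> \<open>Either run may advance while the other waits, so the measure is the total number
  of steps left.\<close>
proof (induction "n + k" arbitrary: n k x y z cs rule: less_induct)
  case less
  note IH = less.hyps and X = less.prems(1) and Y = less.prems(2) and inv = less.prems(3-8)
  have moveZ: ?case if "next_config M z = Some z1"
    "\<exists>z'. (step M)\<^sup>*\<^sup>* z1 z' \<and> next_config M z' = None \<and> emitted z' = emitted x'" for z1
    using that by (meson converse_rtranclp_into_rtranclp)
  show ?case
  proof (cases "head x \<in> I")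
    case inside: True
    hence z: "memory z = memory y" "head z = head y" "head y \<in> I" "stream z (head y) = stream y (head y)"
      using inv by auto
    \<comment> \<open>Inside \<open>I\<close> the hybrid copies \<open>y\<close>; when that step is
      silent, the output of \<open>z\<close> stays equal to that of \<open>x\<close>.\<close>
    have followY: "\<exists>z1. next_config M z = Some z1 \<and> memory z1 = memory y1 \<and> head z1 = head y1 \<and>
       (\<forall>i\<in>I. stream z1 i = stream y1 i) \<and> (\<forall>i. i \<notin> I \<longrightarrow> stream z1 i = stream x i) \<and>
       (emitted y1 = emitted y \<longrightarrow> emitted z1 = emitted x)"
      if "next_config M y = Some y1" for y1
      using next_config_same_view[OF that z(1,2,4)] inv(4-6) z(3) by (smt (verit) append_self_conv fun_upd_apply)
    \<comment> \<open>Here \<open>x\<close> changes only cells of \<open>I\<close>, and there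
      \<open>z\<close> agrees with \<open>y\<close>; so \<open>z\<close> can stand still while
      \<open>x\<close> moves.\<close>
    have soloX: "\<forall>i. i \<notin> I \<longrightarrow> stream x1 i = stream x i" if "next_config M x = Some x1" for x1
      using step_stream_elsewhere[OF that] inside by metis
    from X show ?thesis
    proof cases
      case (stay x1 n')
      show ?thesis
        by (rule IH[OF _ stay(5) Y]) (use stay inside inv soloX[OF stay(2)] in auto)
    next
      case halt
      from Y show ?thesis
      proof cases
        case halt': halt
        hence "next_config M z = None" using z by (simp add: next_config_eq_None_iff)
        then show ?thesis using inv halt by auto
      next
        case (stay y1 k')
        obtain z1 where z1: "next_config M z = Some z1" "memory z1 = memory y1" "head z1 = head y1"
          "\<forall>i\<in>I. stream z1 i = stream y1 i" "\<forall>i. i \<notin> I \<longrightarrow> stream z1 i = stream x i"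
          "emitted z1 = emitted x"
          using followY[OF stay(2)] stay(4) z(3) by auto
        show ?thesis
          by (rule moveZ[OF z1(1)], rule IH[OF _ X stay(5)]) (use stay z z1 inside in auto)
      next
        case cross
        then show ?thesis using halt by simp
      qed
    next
      case (cross x1 n' cs')
      note xc = this
      from Y show ?thesis
      proof cases
        case halt
        then show ?thesis using xc by simp
      next
        case (stay y1 k')
        obtain z1 where z1: "next_config M z = Some z1" "memory z1 = memory y1" "head z1 = head y1"
          "\<forall>i\<in>I. stream z1 i = stream y1 i" "\<forall>i. i \<notin> I \<longrightarrow> stream z1 i = stream x i"
          "emitted z1 = emitted x"
          using followY[OF stay(2)] stay(4) z(3) by auto
        show ?thesis
          by (rule moveZ[OF z1(1)], rule IH[OF _ X stay(5)]) (use stay z z1 inside in auto)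
      next
        case (cross y1 k' cs'')
        obtain z1 where z1: "next_config M z = Some z1" "memory z1 = memory y1" "head z1 = head y1"
          "\<forall>i\<in>I. stream z1 i = stream y1 i" "\<forall>i. i \<notin> I \<longrightarrow> stream z1 i = stream x i"
          "emitted z1 = emitted x"
          using followY[OF cross(3)] cross(5) z(3) by auto
        \<comment> \<open>Both runs record the same crossing, so \<open>z1\<close>, which has just
          copied \<open>y\<close>, also agrees with \<open>x1\<close> and can follow
          \<open>x\<close> from here on.\<close>
        have eq: "memory x1 = memory y1" "head x1 = head y1" "cs'' = cs'"
          using cross(2) xc(2) by auto
        show ?thesis
          by (rule moveZ[OF z1(1)], rule IH[OF _ xc(6) cross(6)[unfolded eq]])
            (use xc cross(1,4) z z1 inside eq soloX[OF xc(3)] in auto)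
      qed
    qed
  next
    \<comment> \<open>The mirror image: \<open>z\<close> copies \<open>x\<close>, emissions
      included, while \<open>y\<close> first runs alone to its next crossing or halt.\<close>
    case outside: False
    hence z: "memory z = memory x" "head z = head x" "head y \<notin> I" "stream z (head x) = stream x (head x)"
      using inv by auto
    have followX: "\<exists>z1. next_config M z = Some z1 \<and> memory z1 = memory x1 \<and> head z1 = head x1 \<and>
       (\<forall>i\<in>I. stream z1 i = stream y i) \<and> (\<forall>i. i \<notin> I \<longrightarrow> stream z1 i = stream x1 i) \<and>
       emitted z1 = emitted x1"
      if "next_config M x = Some x1" for x1
      using next_config_same_view[OF that z(1,2,4)] inv(4-6) outside by (smt (verit) fun_upd_apply)
    have soloY: "\<forall>i. i \<in> I \<longrightarrow> stream y1 i = stream y i" if "next_config M y = Some y1" for y1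
      using step_stream_elsewhere[OF that] z(3) by metis
    from Y show ?thesis
    proof cases
      case (stay y1 k')
      show ?thesis
        by (rule IH[OF _ X stay(5)]) (use stay outside inv soloY[OF stay(2)] in auto)
    next
      case halt
      from X show ?thesis
      proof cases
        case halt': halt
        hence "next_config M z = None" using z by (simp add: next_config_eq_None_iff)
        then show ?thesis using inv halt' by auto
      next
        case (stay x1 n')
        obtain z1 where z1: "next_config M z = Some z1" "memory z1 = memory x1" "head z1 = head x1"
          "\<forall>i\<in>I. stream z1 i = stream y i" "\<forall>i. i \<notin> I \<longrightarrow> stream z1 i = stream x1 i"
          "emitted z1 = emitted x1"
          using followX[OF stay(2)] by auto
        show ?thesis
          by (rule moveZ[OF z1(1)], rule IH[OF _ stay(5) Y]) (use stay z z1 outside in auto)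
      next
        case cross
        then show ?thesis using halt by simp
      qed
    next
      case (cross y1 k' cs')
      note yc = this
      from X show ?thesis
      proof cases
        case halt
        then show ?thesis using yc by simp
      next
        case (stay x1 n')
        obtain z1 where z1: "next_config M z = Some z1" "memory z1 = memory x1" "head z1 = head x1"
          "\<forall>i\<in>I. stream z1 i = stream y i" "\<forall>i. i \<notin> I \<longrightarrow> stream z1 i = stream x1 i"
          "emitted z1 = emitted x1"
          using followX[OF stay(2)] by auto
        show ?thesis
          by (rule moveZ[OF z1(1)], rule IH[OF _ stay(5) Y]) (use stay z z1 outside in auto)
      next
        case (cross x1 n' cs'')
        obtain z1 where z1: "next_config M z = Some z1" "memory z1 = memory x1" "head z1 = head x1"
          "\<forall>i\<in>I. stream z1 i = stream y i" "\<forall>i. i \<notin> I \<longrightarrow> stream z1 i = stream x1 i"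
          "emitted z1 = emitted x1"
          using followX[OF cross(3)] by auto
        have eq: "memory y1 = memory x1" "head y1 = head x1" "cs'' = cs'"
          using cross(2) yc(2) by auto
        show ?thesis
          by (rule moveZ[OF z1(1)], rule IH[OF _ cross(6)[unfolded eq] yc(6)])
            (use yc(1,4) cross(1,4) z z1 outside eq soloY[OF yc(3)] in auto)
      qed
    qed
  qed
qed

text \<open>An upper bound on the number of crossings of \<open>{a..<b}\<close> made so far in the current pass.\<close>

definition crossings_in_pass :: "nat \<Rightarrow> nat \<Rightarrow> config \<Rightarrow> nat" where
  "crossings_in_pass a b c =
     (let zone = if head c < a then 0 else if head c < b then 1 else (2::nat)
      in case heading c of Rightward \<Rightarrow> zone | Leftward \<Rightarrow> 2 - zone)"

text \<open>Within a pass the head meets the zones before, in and after the interval in one order,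
  so each crossing raises the potential by one. On a reversal the growth of
  \<open>2 * passes\<close> pays for the change of \<open>crossings_in_pass\<close> and for a
  crossing made in that step.\<close>

lemma step_crossings:
  assumes "next_config M c = Some c'" "a < b"
  shows "of_bool ((head c \<in> {a..<b}) \<noteq> (head c' \<in> {a..<b})) + 2 * passes c + crossings_in_pass a b c
    \<le> 2 * passes c' + crossings_in_pass a b c'"
  using assms(1)
  by (rule step_cases)
    (use assms(2) in \<open>auto simp: crossings_in_pass_def Let_def split: dir.splits if_splits\<close>)

text \<open>\<open>E\<close> collects the cells scanned while something is emitted, each paid for by
  an output bit. It is fixed before \<open>a\<close> and \<open>b\<close>, so one set serves all
  intervals. The crossing bound sums \<open>step_crossings\<close> along the run; the last
  \<open>2\<close> is the largest value of \<open>crossings_in_pass\<close>.\<close>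

lemma halting_run_silent_run:
  assumes "(step M)\<^sup>*\<^sup>* c d" "next_config M d = None"
    and "\<And>e. (step M)\<^sup>*\<^sup>* c e \<Longrightarrow> length (memory e) \<le> m"
  shows "\<exists>E. finite E \<and> card E + length (emitted c) \<le> length (emitted d) \<and>
    (\<forall>a b. a < b \<longrightarrow> {a..<b} \<inter> E = {} \<longrightarrow>
      (\<exists>n cs. silent_run M {a..<b} n c cs d \<and>
         length cs + 2 * passes c + crossings_in_pass a b c \<le> 2 * passes d + 2 \<and>
         set cs \<subseteq> {q. length q \<le> m} \<times> {..b}))"
  using assms(1,3)
proof (induction rule: converse_rtranclp_induct)
  case base
  show ?case
    by (rule exI[of _ "{}"])
      (auto intro!: exI silent_run.halt[OF assms(2)]
         simp: crossings_in_pass_def Let_def split: dir.splits)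
next
  case (step c c')
  have mem: "length (memory e) \<le> m" if "(step M)\<^sup>*\<^sup>* c' e" for e
    using that step.hyps(1) by (intro step.prems) (auto intro: converse_rtranclp_into_rtranclp)
  from step.IH[OF mem] obtain E where E: "finite E"
    "card E + length (emitted c') \<le> length (emitted d)" and
    runs: "\<And>a b. a < b \<Longrightarrow> {a..<b} \<inter> E = {} \<Longrightarrow>
      (\<exists>n cs. silent_run M {a..<b} n c' cs d \<and>
         length cs + 2 * passes c' + crossings_in_pass a b c' \<le> 2 * passes d + 2 \<and>
         set cs \<subseteq> {q. length q \<le> m} \<times> {..b})"
    by auto
  obtain w where w: "emitted c' = emitted c @ w" using step.hyps(1) by (rule step_cases)
  define E' where "E' = (if w = [] then E else insert (head c) E)"
  \<comment> \<open>Moving by at most one cell, a crossing step ends no further right than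
    \<open>b\<close>.\<close>
  have near: "head c' \<le> head c + 1" "head c \<le> head c' + 1"
    using step.hyps(1) by (auto elim!: step_cases split: dir.splits)
  have "finite E'" using E by (simp add: E'_def)
  moreover have "card E' + length (emitted c) \<le> length (emitted d)"
    using E w by (cases w) (auto simp: E'_def card_insert_if)
  moreover have "\<exists>n cs. silent_run M {a..<b} n c cs d \<and>
         length cs + 2 * passes c + crossings_in_pass a b c \<le> 2 * passes d + 2 \<and>
         set cs \<subseteq> {q. length q \<le> m} \<times> {..b}"
    if ab: "a < b" "{a..<b} \<inter> E' = {}" for a b
  proof -
    have silent: "head c \<in> {a..<b} \<Longrightarrow> emitted c' = emitted c"
      using ab w by (auto simp: E'_def split: if_splits)
    have "{a..<b} \<inter> E = {}" using ab by (auto simp: E'_def split: if_splits)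
    from runs[OF ab(1) this] obtain n cs where run: "silent_run M {a..<b} n c' cs d"
      "length cs + 2 * passes c' + crossings_in_pass a b c' \<le> 2 * passes d + 2"
      "set cs \<subseteq> {q. length q \<le> m} \<times> {..b}" by auto
    note pot = step_crossings[OF step.hyps(1) ab(1)]
    show ?thesis
    proof (cases "(head c \<in> {a..<b}) \<noteq> (head c' \<in> {a..<b})")
      case False
      then have "silent_run M {a..<b} (Suc n) c cs d"
        using silent_run.stay[OF step.hyps(1) _ silent run(1)] by blast
      then show ?thesis using run pot False
        by (intro exI[of _ "Suc n"] exI[of _ cs] conjI) simp_all
    next
      case True
      then have "silent_run M {a..<b} (Suc n) c ((memory c', head c') # cs) d"
        using silent_run.cross[OF step.hyps(1) _ silent run(1)] by blast
      moreover have "head c' \<le> b" using True near ab by auto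
      moreover have "length (memory c') \<le> m" using mem by blast
      ultimately show ?thesis using run pot True
        by (intro exI[of _ "Suc n"] exI[of _ "(memory c', head c') # cs"] conjI) simp_all
    qed
  qed
  ultimately show ?case by blast
qed

section \<open>Splicing two inputs\<close>

definition splice :: "nat set \<Rightarrow> nat list \<Rightarrow> nat list \<Rightarrow> nat list" where
  "splice I y x = map (\<lambda>i. if i \<in> I then y ! i else x ! i) [0..<length x]"

text \<open>Initial configurations differ only in the stream, so the hybrid argument applies from
  the start. Equal lengths make the blank cells agree.\<close>

lemma outputs_splice:
  assumes "length x = length y"
    and "silent_run M I n (init_config M x) cs x'" "silent_run M I k (init_config M y) cs y'"
  shows "outputs M (splice I y x) (emitted x')"
proof -
  have "\<exists>z'. (step M)\<^sup>*\<^sup>* (init_config M (splice I y x)) z' \<and> next_config M z' = None \<and>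
      emitted z' = emitted x'"
    by (rule silent_run_hybrid[OF assms(2,3)]) (use assms(1) in \<open>auto simp: init_config_def splice_def\<close>)
  then show ?thesis by (auto simp: outputs_def reachable_def)
qed

section \<open>Counting crossing sequences\<close>

text \<open>A geometric sum with ratio at least 2 is at most the next power.\<close>

lemma card_lists_length_le_bound:
  assumes "finite A" "2 \<le> card A"
  shows "card {xs. set xs \<subseteq> A \<and> length xs \<le> n} \<le> card A ^ (n + 1)"
proof -
  have "(\<Sum>i\<le>n. card A ^ i) \<le> card A ^ (n + 1)"
  proof (induction n)
    case 0
    then show ?case using assms(2) by simp
  next
    case (Suc n)
    have "(\<Sum>i\<le>Suc n. card A ^ i) \<le> 2 * card A ^ Suc n" using Suc by simp
    also have "\<dots> \<le> card A * card A ^ Suc n" using assms(2) by (rule mult_right_mono) simp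
    finally show ?case by simp
  qed
  then show ?thesis by (simp add: card_lists_length_le[OF assms(1)])
qed

lemma length_concat_replicate [simp]: "length (concat (replicate k t)) = k * length t"
  by (induction k) auto

lemma nth_concat_replicate:
  "i < k * length t \<Longrightarrow> concat (replicate k t) ! i = t ! (i mod length t)"
proof (induction k arbitrary: i)
  case (Suc k)
  then show ?case
    by (cases "i < length t") (auto simp: nth_append le_mod_geq)
qed simp

text \<open>Pigeonhole: fewer than \<open>k\<close> cells see an emission, so one of the
  \<open>k\<close> blocks of length \<open>L\<close> contains none of them.\<close>

lemma exists_silent_block:
  fixes k L :: nat
  assumes "(step M)\<^sup>*\<^sup>* c d" "next_config M d = None"
    and "\<And>e. (step M)\<^sup>*\<^sup>* c e \<Longrightarrow> length (memory e) \<le> m"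
    and "length (emitted d) < k" "0 < L" "passes c = 1"
  shows "\<exists>b n cs. b < k \<and> silent_run M {b * L..<b * L + L} n c cs d \<and>
    length cs \<le> 2 * passes d \<and> set cs \<subseteq> {q. length q \<le> m} \<times> {..k * L}"
proof -
  obtain E where E: "finite E" "card E + length (emitted c) \<le> length (emitted d)" and
    runs: "\<And>a b. a < b \<Longrightarrow> {a..<b} \<inter> E = {} \<Longrightarrow>
      (\<exists>n cs. silent_run M {a..<b} n c cs d \<and>
         length cs + 2 * passes c + crossings_in_pass a b c \<le> 2 * passes d + 2 \<and>
         set cs \<subseteq> {q. length q \<le> m} \<times> {..b})"
    using halting_run_silent_run[OF assms(1-3)] by metis
  \<comment> \<open>Division by \<open>L\<close> sends a cell to the index of its block.\<close>
  have "card ((\<lambda>e. e div L) ` E) < card {..<k}"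
    using card_image_le[OF E(1), of "\<lambda>e. e div L"] E(2) assms(4) by simp
  then have "\<not> {..<k} \<subseteq> (\<lambda>e. e div L) ` E"
    using card_mono[of "(\<lambda>e. e div L) ` E" "{..<k}"] E(1) by auto
  then obtain b where b: "b < k" "b \<notin> (\<lambda>e. e div L) ` E" by auto
  have "e div L = b" if "e \<in> {b * L..<b * L + L}" for e
    using that by (auto intro!: div_nat_eqI simp: algebra_simps)
  then have "{b * L..<b * L + L} \<inter> E = {}" using b(2) by blast
  from runs[OF _ this] assms(5) obtain n cs where run: "silent_run M {b * L..<b * L + L} n c cs d"
    "length cs + 2 * passes c \<le> 2 * passes d + 2" "set cs \<subseteq> {q. length q \<le> m} \<times> {..b * L + L}"
    by auto
  have "b * L + L \<le> k * L" using b(1) by (metis Suc_leI add.commute mult_Suc mult_le_mono1)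
  then have "{q. length q \<le> m} \<times> {..b * L + L} \<subseteq> {q. length q \<le> m} \<times> {..k * L}" by auto
  \<comment> \<open>As \<open>passes c = 1\<close>, the term \<open>2 * passes c\<close> cancels the
    \<open>+ 2\<close>.\<close>
  then show ?thesis
    using run b(1) assms(6) by (intro exI[of _ b] exI[of _ n] exI[of _ cs]) auto
qed

text \<open>Two periodic inputs with the same silent block and the same crossing sequence there would have
  the same output as their splice, so crossing sequences tell the \<open>card A ^ L\<close> periods apart.\<close>

lemma crossing_sequence_bound:
  fixes k L m p :: nat
  assumes "finite A" "0 < L" "0 < k"
    and mem: "\<And>s. length s = k * L \<Longrightarrow> set s \<subseteq> A \<Longrightarrow> uses_memory M s m"
    and pass: "\<And>s. length s = k * L \<Longrightarrow> set s \<subseteq> A \<Longrightarrow> uses_passes M s p"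
    and out: "\<And>s. length s = k * L \<Longrightarrow> set s \<subseteq> A \<Longrightarrow> outputs M s (out s)"
    and inj: "inj_on out {s. length s = k * L \<and> set s \<subseteq> A}"
    and short: "\<And>t. length t = L \<Longrightarrow> set t \<subseteq> A \<Longrightarrow> length (out (concat (replicate k t))) < k"
  shows "card A ^ L \<le> k * (2 ^ (m + 1) * (k * L + 1)) ^ (2 * p + 1)"
proof -
  define P where "P = {t. set t \<subseteq> A \<and> length t = L}"
  define Q where "Q = {q :: bool list. length q \<le> m} \<times> {..k * L}"
  define C where "C = {cs. set cs \<subseteq> Q \<and> length cs \<le> 2 * p}"
  define rep where "rep t = concat (replicate k t)" for t :: "nat list"
  define blk where "blk b = {b * L..<b * L + L}" for b
  have rep: "length (rep t) = k * L" "set (rep t) \<subseteq> A" if "t \<in> P" for t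
    using that by (auto simp: rep_def P_def)
  have "\<exists>b cs n d. b < k \<and> cs \<in> C \<and>
      silent_run M (blk b) n (init_config M (rep t)) cs d \<and> emitted d = out (rep t)"
    if t: "t \<in> P" for t
  proof -
    obtain d where d: "(step M)\<^sup>*\<^sup>* (init_config M (rep t)) d" "next_config M d = None"
      "emitted d = out (rep t)"
      using out[OF rep[OF t]] by (auto simp: outputs_def reachable_def)
    have "length (emitted d) < k" using short[of t] t d(3) by (simp add: P_def rep_def)
    from exists_silent_block[OF d(1,2) _ this \<open>0 < L\<close>, of m]
    obtain b n cs where b: "b < k" "silent_run M (blk b) n (init_config M (rep t)) cs d"
      "length cs \<le> 2 * passes d" "set cs \<subseteq> Q"
      using mem[OF rep[OF t]]
      by (auto simp: uses_memory_def reachable_def Q_def blk_def init_config_def)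
    have "passes d \<le> p"
      using pass[OF rep[OF t]] d(1) by (auto simp: uses_passes_def reachable_def)
    then have "cs \<in> C" using b by (auto simp: C_def)
    then show ?thesis using b d by blast
  qed
  then obtain b cs n d where run: "\<And>t. t \<in> P \<Longrightarrow> b t < k \<and> cs t \<in> C \<and>
      silent_run M (blk (b t)) (n t) (init_config M (rep t)) (cs t) (d t) \<and> emitted (d t) = out (rep t)"
    by metis
  have "inj_on (\<lambda>t. (b t, cs t)) P"
  proof (rule inj_onI)
    fix t u assume t: "t \<in> P" and u: "u \<in> P" and eq: "(b t, cs t) = (b u, cs u)"
    \<comment> \<open>The block of \<open>u\<close> replaces that of \<open>t\<close>; equal
      crossing sequences keep the output of \<open>rep t\<close>.\<close>
    let ?s = "splice (blk (b t)) (rep u) (rep t)"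
    have s: "length ?s = k * L" "set ?s \<subseteq> A"
      using rep[OF t] rep[OF u] by (auto simp: splice_def subset_iff)
    have "outputs M ?s (emitted (d t))"
      by (rule outputs_splice) (use run[OF t] run[OF u] eq rep[OF t] rep[OF u] in auto)
    then have "out ?s = out (rep t)" using out[OF s] run[OF t] by (auto dest: outputs_unique)
    \<comment> \<open>Outputs determine inputs of this length, so splicing changed nothing and the
      two blocks agree.\<close>
    then have s_eq: "?s = rep t" using inj s rep[OF t] by (auto simp: inj_on_def)
    show "t = u"
    proof (rule nth_equalityI)
      show "length t = length u" using t u by (simp add: P_def)
      fix i assume "i < length t"
      then have i: "i < L" using t by (simp add: P_def)
      have "b t * L + i < (b t + 1) * L" using i by simp
      also have "\<dots> \<le> k * L" using run[OF t] by (intro mult_right_mono) auto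
      finally have bi: "b t * L + i < k * L" .
      have "rep u ! (b t * L + i) = ?s ! (b t * L + i)"
        using bi i rep[OF t] by (simp add: splice_def blk_def)
      also have "\<dots> = rep t ! (b t * L + i)" using s_eq by simp
      finally show "t ! i = u ! i"
        using bi i t u by (simp add: rep_def P_def nth_concat_replicate)
    qed
  qed
  moreover have "(\<lambda>t. (b t, cs t)) ` P \<subseteq> {..<k} \<times> C" using run by auto
  moreover have fQ: "finite Q"
    using finite_lists_length_le[of "UNIV :: bool set" m] by (simp add: Q_def)
  then have "finite C" by (simp add: C_def finite_lists_length_le)
  ultimately have "card P \<le> card ({..<k} \<times> C)" by (intro card_inj_on_le) auto
  then have "card P \<le> k * card C" by (simp add: card_cartesian_product)
  moreover have "card P = card A ^ L" using card_lists_length_eq[OF assms(1)] by (simp add: P_def)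
  moreover have "card C \<le> (2 ^ (m + 1) * (k * L + 1)) ^ (2 * p + 1)"
  proof -
    have "card {q :: bool list. length q \<le> m} \<le> 2 ^ (m + 1)"
      using card_lists_length_le_bound[of "UNIV :: bool set" m] by simp
    then have le: "card Q \<le> 2 ^ (m + 1) * (k * L + 1)"
      unfolding Q_def card_cartesian_product by (simp add: mult_le_mono1 del: mult_Suc_right power_Suc)
    \<comment> \<open>Two distinct records give the ratio of at least 2 that the geometric bound
      asks for; position 1 is in range because \<open>k * L\<close> is positive.\<close>
    have "{([], 0), ([], 1)} \<subseteq> Q" using assms(2,3) by (auto simp: Q_def)
    from card_mono[OF fQ this] have "2 \<le> card Q" by simp
    from card_lists_length_le_bound[OF fQ this, of "2 * p"] have "card C \<le> card Q ^ (2 * p + 1)"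
      by (simp add: C_def)
    also have "\<dots> \<le> (2 ^ (m + 1) * (k * L + 1)) ^ (2 * p + 1)" using le by (rule power_mono) simp
    finally show ?thesis .
  qed
  ultimately show ?thesis by (metis le_trans mult_le_mono2)
qed

section \<open>A small grammar for a periodic string\<close>

text \<open>\<open>N i\<close> stands for \<open>2 ^ i\<close> copies of \<open>t\<close>: one
  production spells out \<open>t\<close>, and \<open>j\<close> productions of length two double
  it.\<close>

definition doubling_grammar :: "nat \<Rightarrow> nat list \<Rightarrow> cfg" where
  "doubling_grammar j t = CFG j ((0, map T t) # map (\<lambda>i. (Suc i, [N i, N i])) [0..<j])"

text \<open>The intended value of a symbol. Concatenated over a sentential form, it is invariant
  under derivation, which shows that no other string is generated.\<close>

fun expand :: "nat list \<Rightarrow> sym \<Rightarrow> nat list" where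
  "expand t (T a) = [a]"
| "expand t (N i) = concat (replicate (2 ^ i) t)"

lemma concat_map_expand_T [simp]: "concat (map (expand t \<circ> T) w) = w"
  by (induction w) auto

lemma derives1_doubling_grammar:
  "derives1 (doubling_grammar j t) x y \<Longrightarrow> concat (map (expand t) x) = concat (map (expand t) y)"
  by (auto simp: derives1_def doubling_grammar_def replicate_add mult_2)

lemma derives1I: "(A, \<alpha>) \<in> set (prods G) \<Longrightarrow> derives1 G (u @ [N A] @ v) (u @ \<alpha> @ v)"
  unfolding derives1_def by blast

lemma derives1_in_context:
  assumes "derives1 G x y"
  shows "derives1 G (u @ x @ v) (u @ y @ v)"
proof -
  obtain u' A \<alpha> v' where "(A, \<alpha>) \<in> set (prods G)" "x = u' @ [N A] @ v'" "y = u' @ \<alpha> @ v'"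
    using assms unfolding derives1_def by blast
  then show ?thesis using derives1I[of A \<alpha> G "u @ u'" "v' @ v"] by simp
qed

lemma derives_in_context:
  "(derives1 G)\<^sup>*\<^sup>* x y \<Longrightarrow> (derives1 G)\<^sup>*\<^sup>* (u @ x @ v) (u @ y @ v)"
  by (induction rule: rtranclp_induct) (auto intro: rtranclp.rtrancl_into_rtrancl derives1_in_context)

lemma derives1_production: "(A, \<alpha>) \<in> set (prods G) \<Longrightarrow> derives1 G [N A] \<alpha>"
  using derives1I[of A \<alpha> G "[]" "[]"] by simp

lemma doubling_grammar_derives:
  "i \<le> j \<Longrightarrow> (derives1 (doubling_grammar j t))\<^sup>*\<^sup>* [N i] (map T (concat (replicate (2 ^ i) t)))"
proof (induction i)
  case 0
  then show ?case
    using derives1_production[of 0 "map T t" "doubling_grammar j t"]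
    by (auto simp: doubling_grammar_def)
next
  case (Suc i)
  let ?D = "(derives1 (doubling_grammar j t))\<^sup>*\<^sup>*"
  let ?w = "map T (concat (replicate (2 ^ i) t))"
  have IH: "?D [N i] ?w" using Suc by simp
  have "derives1 (doubling_grammar j t) [N (Suc i)] [N i, N i]"
    using Suc.prems by (intro derives1_production) (auto simp: doubling_grammar_def)
  also have "?D [N i, N i] (?w @ [N i])" using derives_in_context[OF IH, of "[]" "[N i]"] by simp
  also have "?D (?w @ [N i]) (?w @ ?w)" using derives_in_context[OF IH, of ?w "[]"] by simp
  finally show ?case by (simp add: mult_2 replicate_add)
qed

lemma generates_only_doubling_grammar:
  "generates_only (doubling_grammar j t) (concat (replicate (2 ^ j) t))"
proof -
  have "concat (map (expand t) x) = concat (map (expand t) y)"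
    if "(derives1 (doubling_grammar j t))\<^sup>*\<^sup>* x y" for x y
    using that by induction (auto dest: derives1_doubling_grammar)
  then have "w = concat (replicate (2 ^ j) t)"
    if "(derives1 (doubling_grammar j t))\<^sup>*\<^sup>* [N j] (map T w)" for w
    using that by fastforce
  moreover have "start (doubling_grammar j t) = j" by (simp add: doubling_grammar_def)
  ultimately show ?thesis
    using doubling_grammar_derives[OF order_refl, of j t]
    unfolding generates_only_def language_def by (metis (mono_tags, lifting) Collect_cong singleton_conv)
qed

section \<open>Code lengths\<close>

text \<open>A linear bound on a code of logarithmic length is enough: the nonterminals run only up
  to \<open>j\<close>, the logarithm of the number of copies.\<close>

lemma length_nat_code_le: "length (nat_code x) \<le> 2 * x + 1"
proof (induction x rule: nat_code.induct)
  case (2 n)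
  have "Suc n div 2 \<le> n" by simp
  then show ?case using 2 by simp
qed simp

lemma length_list_code_le:
  "(\<And>x. x \<in> set xs \<Longrightarrow> length (f x) \<le> K) \<Longrightarrow> length (list_code f xs) \<le> length xs * (K + 1) + 1"
  by (induction xs) force+

text \<open>A letter 0 or 1 takes at most three bits, plus a tag and a list flag, hence
  \<open>5 * length t\<close>. Each of the \<open>j\<close> doubling productions is linear in
  \<open>j\<close>, hence the quadratic term.\<close>

lemma cfg_size_doubling_grammar:
  assumes "set t \<subseteq> {0, 1}"
  shows "cfg_size (doubling_grammar j t) \<le> 5 * length t + 6 * j ^ 2 + 14 * j + 6"
proof -
  have "length (list_code sym_code (map T t)) \<le> length (map T t) * (4 + 1) + 1"
    by (rule length_list_code_le) (use assms in auto)
  moreover have "length (prod_code (Suc i, [N i, N i])) \<le> 6 * j + 5" if "i < j" for i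
    using that length_nat_code_le[of "Suc i"] length_nat_code_le[of i] by simp
  then have "length (list_code prod_code (map (\<lambda>i. (Suc i, [N i, N i])) [0..<j]))
      \<le> length (map (\<lambda>i. (Suc i, [N i, N i])) [0..<j]) * ((6 * j + 5) + 1) + 1"
    by (intro length_list_code_le) auto
  ultimately show ?thesis
    using length_nat_code_le[of j]
    by (simp add: cfg_size_def cfg_code_def doubling_grammar_def power2_eq_square algebra_simps)
qed

section \<open>The lower bound\<close>

lemma eventually_power_less_exp:
  "\<forall>\<^sub>F j in sequentially. (2 * j) ^ D < (2 :: nat) ^ j"
proof -
  have "\<forall>\<^sub>F j in sequentially. (2 * real j) ^ D < 2 ^ j"
    by real_asymp
  then show ?thesis
  proof eventually_elim
    case (elim j)
    then have "real ((2 * j) ^ D) < real (2 ^ j)" by simp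
    then show ?case by (simp only: of_nat_less_iff)
  qed
qed

text \<open>Replaces the real logarithm by any \<open>l\<close> with \<open>n \<le> 2 ^ l\<close>,
  and leaves the exponent free to grow so that one exponent can serve both memory and
  passes.\<close>

lemma polylogD:
  assumes "polylog f"
  obtains c n\<^sub>0 where
    "\<And>n l e. n\<^sub>0 \<le> n \<Longrightarrow> n \<le> 2 ^ l \<Longrightarrow> 0 < l \<Longrightarrow> c \<le> e \<Longrightarrow> f n \<le> l ^ e"
proof -
  obtain c n\<^sub>0 where f: "\<And>n. n\<^sub>0 \<le> n \<Longrightarrow> real (f n) \<le> log 2 (real n) ^ c"
    using assms unfolding polylog_def eventually_sequentially by blast
  \<comment> \<open>The \<open>max 1\<close> keeps the logarithm nonnegative, as monotonicity of
    powers requires.\<close>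
  have "f n \<le> l ^ e" if "max 1 n\<^sub>0 \<le> n" "n \<le> 2 ^ l" "0 < l" "c \<le> e" for n l e
  proof -
    have "real n \<le> 2 ^ l" using that(2) by (metis of_nat_le_iff of_nat_numeral of_nat_power)
    then have "log 2 (real n) \<le> real l" using that(1) by (simp add: log_le_iff powr_realpow)
    moreover have "0 \<le> log 2 (real n)" using that(1) by simp
    ultimately have "log 2 (real n) ^ c \<le> real l ^ c" by (rule power_mono)
    then have "real (f n) \<le> real (l ^ c)" using order_trans[OF f[of n]] that(1) by fastforce
    then have "f n \<le> l ^ c" by (simp only: of_nat_le_iff)
    also have "\<dots> \<le> l ^ e" using that by (intro power_increasing) auto
    finally show ?thesis .
  qed
  then show thesis using that[of "max 1 n\<^sub>0" c] by simp
qed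

text \<open>The product is at most \<open>9 * (y ^ 2 * l)\<close> and \<open>j\<close> adds at most
  one more such term, while \<open>l ^ 3\<close> is at least 64.\<close>

lemma crossing_exponent_less:
  fixes l y j m p :: nat
  assumes "4 \<le> l" "1 \<le> y" "j \<le> l" "m \<le> y" "p \<le> y"
  shows "j + (m + 1 + (l + 1)) * (2 * p + 1) < y ^ 2 * l ^ 4"
proof -
  have yl: "y \<le> y * l" "l \<le> y * l" "2 \<le> y * l" using assms mult_le_mono[of 1 y 4 l] by auto
  then have "m + 1 + (l + 1) \<le> 3 * (y * l)" using assms by linarith
  moreover have "2 * p + 1 \<le> 3 * y" using assms by linarith
  ultimately have "(m + 1 + (l + 1)) * (2 * p + 1) \<le> 3 * (y * l) * (3 * y)"
    by (rule mult_le_mono)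
  also have "\<dots> = 9 * (y ^ 2 * l)" by (simp add: power2_eq_square)
  finally have "(m + 1 + (l + 1)) * (2 * p + 1) \<le> 9 * (y ^ 2 * l)" .
  moreover have "j \<le> y ^ 2 * l" using assms by (intro order_trans[OF assms(3)]) simp
  moreover have "64 * (y ^ 2 * l) \<le> l ^ 3 * (y ^ 2 * l)"
    using power_mono[OF assms(1), of 3] by (intro mult_right_mono) auto
  moreover have "l ^ 3 * (y ^ 2 * l) = y ^ 2 * l ^ 4" by (simp add: eval_nat_numeral)
  moreover have "0 < y ^ 2 * l" using assms by simp
  ultimately show ?thesis by linarith
qed

text \<open>Every summand is at most a small multiple of \<open>l ^ D\<close>, and the factor
  \<open>l ^ 3\<close>, at least 64, absorbs them all.\<close>

lemma doubling_grammar_size_le: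
  fixes l j D :: nat
  assumes "4 \<le> l" "l = 2 * j" "2 \<le> D"
  shows "5 * l ^ D + 6 * j ^ 2 + 14 * j + 6 \<le> l ^ (D + 3)"
proof -
  have "l ^ 2 \<le> l ^ D" using assms by (intro power_increasing) auto
  moreover have "6 * j ^ 2 \<le> 2 * l ^ 2" "4 * l \<le> l ^ 2" "16 \<le> l ^ 2"
    using assms mult_le_mono[of 4 l 4 l] by (simp_all add: power2_eq_square)
  moreover have "64 * l ^ D \<le> l ^ 3 * l ^ D"
    using power_mono[OF assms(1), of 3] by (intro mult_right_mono) auto
  moreover have "l ^ 3 * l ^ D = l ^ (D + 3)" by (simp add: power_add)
  ultimately show ?thesis using assms(2) by linarith
qed

theorem theorem4:
  fixes \<sigma> :: nat
  assumes "2 \<le> \<sigma>"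
  shows "\<not> (\<exists>(M :: algorithm) (m :: nat \<Rightarrow> nat) (p :: nat \<Rightarrow> nat) (c :: nat).
            polylog m \<and> polylog p \<and>
            (\<forall>s. set s \<subseteq> {..<\<sigma>} \<longrightarrow>
               uses_memory M s (m (length s)) \<and>
               uses_passes M s (p (length s)) \<and>
               (\<exists>APPROX. outputs M s (cfg_code APPROX) \<and>
                  generates_only APPROX s \<and>
                  (\<forall>OPT. smallest_grammar OPT s \<longrightarrow> cfg_size APPROX \<le> cfg_size OPT ^ c))))"
proof (intro notI, elim exE conjE)
  fix M m p c
  assume m: "polylog m" and p: "polylog p" and alg: "\<forall>s. set s \<subseteq> {..<\<sigma>} \<longrightarrow>
               uses_memory M s (m (length s)) \<and>
               uses_passes M s (p (length s)) \<and>
               (\<exists>APPROX. outputs M s (cfg_code APPROX) \<and>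
                  generates_only APPROX s \<and>
                  (\<forall>OPT. smallest_grammar OPT s \<longrightarrow> cfg_size APPROX \<le> cfg_size OPT ^ c))"
  \<comment> \<open>Two letters suffice for the hard inputs, and \<open>2 \<le> \<sigma>\<close>
    provides them.\<close>
  define A :: "nat set" where "A = {0, 1}"
  have A: "set s \<subseteq> A \<Longrightarrow> set s \<subseteq> {..<\<sigma>}" for s using assms by (auto simp: A_def)
  have card_A: "card A = 2" by (simp add: A_def)
  have "\<forall>s. \<exists>G. set s \<subseteq> A \<longrightarrow> outputs M s (cfg_code G) \<and> generates_only G s \<and>
      (\<forall>OPT. smallest_grammar OPT s \<longrightarrow> cfg_size G \<le> cfg_size OPT ^ c)"
    using alg A by meson
  then obtain G where G: "\<And>s. set s \<subseteq> A \<Longrightarrow> outputs M s (cfg_code (G s))"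
    "\<And>s. set s \<subseteq> A \<Longrightarrow> generates_only (G s) s"
    "\<And>s OPT. set s \<subseteq> A \<Longrightarrow> smallest_grammar OPT s \<Longrightarrow> cfg_size (G s) \<le> cfg_size OPT ^ c"
    by metis
  obtain c\<^sub>m n\<^sub>m where m_le:
    "\<And>n l e. n\<^sub>m \<le> n \<Longrightarrow> n \<le> 2 ^ l \<Longrightarrow> 0 < l \<Longrightarrow> c\<^sub>m \<le> e \<Longrightarrow> m n \<le> l ^ e"
    using polylogD[OF m] by metis
  obtain c\<^sub>p n\<^sub>p where p_le:
    "\<And>n l e. n\<^sub>p \<le> n \<Longrightarrow> n \<le> 2 ^ l \<Longrightarrow> 0 < l \<Longrightarrow> c\<^sub>p \<le> e \<Longrightarrow> p n \<le> l ^ e"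
    using polylogD[OF p] by metis
  define e where "e = max c\<^sub>m c\<^sub>p"
  \<comment> \<open>Chosen so that \<open>L = (l ^ e) ^ 2 * l ^ 4\<close>, the bound in
    \<open>crossing_exponent_less\<close>.\<close>
  define D where "D = 2 * e + 4"
  \<comment> \<open>The first condition gives \<open>L < k\<close> and so
    \<open>n \<le> 2 ^ l\<close>, the second makes the output shorter than \<open>k\<close>, and the
    third puts \<open>n\<close> beyond both thresholds.\<close>
  have "\<forall>\<^sub>F j in sequentially. (2 * j) ^ D < (2 :: nat) ^ j \<and> (2 * j) ^ ((D + 3) * c) < (2 :: nat) ^ j
      \<and> max 2 (max n\<^sub>m n\<^sub>p) \<le> j"
    by (intro eventually_conj eventually_power_less_exp eventually_ge_at_top)
  then obtain j where j: "(2 * j) ^ D < (2 :: nat) ^ j" "(2 * j) ^ ((D + 3) * c) < (2 :: nat) ^ j"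
    "2 \<le> j" "n\<^sub>m \<le> j" "n\<^sub>p \<le> j"
    by (auto simp: eventually_sequentially)
  define l where "l = 2 * j"
  define L where "L = l ^ D"
  define k :: nat where "k = 2 ^ j"
  define n where "n = k * L"
  have l: "4 \<le> l" and L: "0 < L" using j(3) by (auto simp: l_def L_def)
  have "k * L \<le> k * k" using j(1) by (intro mult_le_mono2) (simp add: L_def l_def k_def)
  then have n_le: "n \<le> 2 ^ l" by (simp add: n_def k_def l_def mult_2 power_add)
  have "j \<le> k" by (simp add: k_def less_imp_le)
  also have "\<dots> \<le> n" using L by (simp add: n_def)
  finally have "j \<le> n" .
  then have mn: "m n \<le> l ^ e" and pn: "p n \<le> l ^ e"
    using m_le[OF _ n_le] p_le[OF _ n_le] j l by (auto simp: e_def)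
  have kL: "k * L + 1 \<le> 2 ^ (l + 1)"
    using add_mono[OF n_le one_le_power[of "2 :: nat" l]] by (simp add: n_def)
  have "card A ^ L \<le> k * (2 ^ (m n + 1) * (k * L + 1)) ^ (2 * p n + 1)"
  proof (rule crossing_sequence_bound)
    fix s :: "nat list" assume s: "length s = k * L" "set s \<subseteq> A"
    then show "uses_memory M s (m n)" "uses_passes M s (p n)"
      using alg A[of s] by (auto simp: n_def)
    show "outputs M s (cfg_code (G s))" using G(1) s by blast
  next
    \<comment> \<open>A grammar that generates a single string determines it, so with
      \<open>inj_cfg_code\<close> the output determines the input.\<close>
    have "G s = G t \<Longrightarrow> s = t" if "set s \<subseteq> A" "set t \<subseteq> A" for s t
      using G(2)[OF that(1)] G(2)[OF that(2)] by (simp add: generates_only_def)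
    then show "inj_on (\<lambda>s. cfg_code (G s)) {s. length s = k * L \<and> set s \<subseteq> A}"
      using inj_cfg_code by (auto simp: inj_on_def inj_def)
  next
    fix t assume t: "length t = L" "set t \<subseteq> A"
    let ?s = "concat (replicate k t)"
    have s: "set ?s \<subseteq> A" using t by auto
    \<comment> \<open>The size guarantee is conditional on a smallest grammar, so one must exist
      before the guarantee yields a bound.\<close>
    obtain OPT where OPT: "smallest_grammar OPT ?s" using ex_smallest_grammar by blast
    have "cfg_size OPT \<le> cfg_size (doubling_grammar j t)"
      using OPT generates_only_doubling_grammar[of j t] by (simp add: smallest_grammar_def k_def)
    also have "\<dots> \<le> 5 * l ^ D + 6 * j ^ 2 + 14 * j + 6"
      using cfg_size_doubling_grammar[of t j] t by (simp add: A_def L_def)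
    also have "\<dots> \<le> l ^ (D + 3)"
      using l by (rule doubling_grammar_size_le) (auto simp: l_def D_def)
    finally have "cfg_size OPT ^ c \<le> (l ^ (D + 3)) ^ c" by (rule power_mono) simp
    also have "\<dots> < k" using j(2) by (simp only: l_def k_def power_mult)
    finally show "length (cfg_code (G ?s)) < k"
      using G(3)[OF s OPT] by (simp add: cfg_size_def)
  qed (use L in \<open>auto simp: A_def k_def\<close>)
  also have "\<dots> \<le> k * (2 ^ (m n + 1) * 2 ^ (l + 1)) ^ (2 * p n + 1)"
    using kL by (intro mult_le_mono2 power_mono) auto
  also have "\<dots> = 2 ^ (j + (m n + 1 + (l + 1)) * (2 * p n + 1))"
    unfolding k_def by (simp only: power_add power_mult)
  finally have "2 ^ L \<le> (2 :: nat) ^ (j + (m n + 1 + (l + 1)) * (2 * p n + 1))"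
    by (simp only: card_A)
  \<comment> \<open>Comparing exponents of 2 leaves a polynomial inequality in \<open>l\<close> that
    the choice of \<open>D\<close> refutes.\<close>
  then have "L \<le> j + (m n + 1 + (l + 1)) * (2 * p n + 1)" by (rule power_le_imp_le_exp[rotated]) simp
  moreover have "j + (m n + 1 + (l + 1)) * (2 * p n + 1) < (l ^ e) ^ 2 * l ^ 4"
    using l mn pn by (intro crossing_exponent_less) (auto simp: l_def)
  moreover have "(l ^ e) ^ 2 * l ^ 4 = L"
    by (simp add: L_def D_def power_add mult.commute flip: power_mult)
  ultimately show False by simp
qed

end
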